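(* Consider the irreducible two-state Markov chain with state space $\{1,2\}$ and transition matrix $P=\begin{bmatrix} 1-a & a \\ b & 1-b \end{bmatrix}$, $0<a\le1$, $0<b\le1$, and let $d=1-a-b$ (so $-1\le d<1$). Then the expected mixing times do not depend on the starting state and satisfy $$E[T_1^{(0)}]=E[T_2^{(0)}]=\frac{1}{1-d}=\tau,\qquad E[T_1^{(1)}]=E[T_2^{(1)}]=1+\frac{1}{1-d}=\eta,$$ where $\tau$ and $\eta$ denote the respective common values.
   Context: The stationary distribution is $\pi_1=b/(1-d)$, $\pi_2=a/(1-d)$. The mixing variable $M$ is a random variable, independent of the chain, with $P[M=j]=\pi_j$ for $j\in\{1,2\}$. Given $X_0=i$, $T_i^{(0)}=\min\{n\ge 0: X_n=M\}$ and $T_i^{(1)}=\min\{n\ge 1: X_n=M\}$; the expectations are conditional on $X_0=i$. *)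

theory Defs
  imports "HOL-Probability.Probability"
begin

(* The states 1 and 2 are the two elements of the type 2 (where the numeral 2 equals 0), so a
   transition matrix has type real^2^2 and P $ i $ j is the probability of the step from i to j. *)

definition two_state_matrix :: "real \<Rightarrow> real \<Rightarrow> real^2^2" where
  "two_state_matrix a b = vector [vector [1 - a, a], vector [b, 1 - b]]"

(* Time-homogeneous Markov chain with arbitrary initial law.  The path x_0, ..., x_n of the
   conditioning event is the initial segment of the function x. *)
definition markov_chain ::
  "'w measure \<Rightarrow> real^'s^'s \<Rightarrow> (nat \<Rightarrow> 'w \<Rightarrow> 's::finite) \<Rightarrow> bool" where
  "markov_chain W P X \<longleftrightarrow>
     (\<forall>n. X n \<in> W \<rightarrow>\<^sub>M count_space UNIV) \<and>
     (\<forall>n x j. \<P>(w in W. \<forall>k\<le>n. X k w = x k) > 0 \<longrightarrow>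
        \<P>(w in W. X (Suc n) w = j \<bar> \<forall>k\<le>n. X k w = x k) = P $ x n $ j)"

definition stationary_distribution :: "real^'s^'s \<Rightarrow> real^'s::finite \<Rightarrow> bool" where
  "stationary_distribution P p \<longleftrightarrow>
     (\<forall>j. p $ j \<ge> 0) \<and> (\<Sum>j\<in>UNIV. p $ j) = 1 \<and> p v* P = p"

definition two_state_stationary :: "real \<Rightarrow> real \<Rightarrow> real^2" where
  "two_state_stationary a b = (let d = 1 - a - b in vector [b / (1 - d), a / (1 - d)])"

lemma stationary_distribution_two_state_iff:
  assumes "0 < a" "0 < b"
  shows "stationary_distribution (two_state_matrix a b) p \<longleftrightarrow> p = two_state_stationary a b"
proof -
  have ab: "a + b > 0" using assms by linarith
  have st: "stationary_distribution (two_state_matrix a b) p \<longleftrightarrow>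
      p $ 1 \<ge> 0 \<and> p $ 2 \<ge> 0 \<and> p $ 1 + p $ 2 = 1 \<and>
      (1 - a) * p $ 1 + b * p $ 2 = p $ 1 \<and> a * p $ 1 + (1 - b) * p $ 2 = p $ 2"
    by (simp add: stationary_distribution_def two_state_matrix_def vec_eq_iff forall_2 sum_2
        vector_matrix_mult_def mult.commute)
  have eq: "p = two_state_stationary a b \<longleftrightarrow> p $ 1 * (a + b) = b \<and> p $ 2 * (a + b) = a"
    using ab by (simp add: two_state_stationary_def vec_eq_iff forall_2 eq_divide_eq)
  show ?thesis unfolding st eq
  proof safe
    assume s: "p $ 1 + p $ 2 = 1" and e: "(1 - a) * p $ 1 + b * p $ 2 = p $ 1"
    have p2: "p $ 2 = 1 - p $ 1" using s by linarith
    show "p $ 1 * (a + b) = b" using e unfolding p2 by (simp add: algebra_simps)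
    then show "p $ 2 * (a + b) = a" unfolding p2 by (simp add: algebra_simps)
  next
    assume 1: "p $ 1 * (a + b) = b" and 2: "p $ 2 * (a + b) = a"
    have p1: "p $ 1 = b / (a + b)" and p2: "p $ 2 = a / (a + b)"
      using 1 2 ab by (simp_all add: eq_divide_eq)
    show "p $ 1 \<ge> 0" "p $ 2 \<ge> 0" using assms by (simp_all add: p1 p2)
    show "p $ 1 + p $ 2 = 1"
      using ab unfolding p1 p2 add_divide_distrib[symmetric] by simp
    show "(1 - a) * p $ 1 + b * p $ 2 = p $ 1" "a * p $ 1 + (1 - b) * p $ 2 = p $ 2"
      unfolding p1 p2 by (simp_all add: algebra_simps diff_divide_distrib)
  qed
qed

(* M is independent of the whole process X, not merely of each X n. *)
definition indep_of_process ::
  "'w measure \<Rightarrow> ('w \<Rightarrow> 's) \<Rightarrow> (nat \<Rightarrow> 'w \<Rightarrow> 's) \<Rightarrow> bool" where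
  "indep_of_process W M X \<longleftrightarrow>
     M \<in> W \<rightarrow>\<^sub>M count_space UNIV \<and>
     prob_space.indep_set W
       (sets (vimage_algebra (space W) M (count_space UNIV)))
       (sets (vimage_algebra (space W) (\<lambda>w n. X n w) (\<Pi>\<^sub>M n\<in>UNIV. count_space UNIV)))"

(* min {n. n >= k and X n = M}, with the value infinity if there is no such n. *)
definition mixing_time :: "nat \<Rightarrow> (nat \<Rightarrow> 'w \<Rightarrow> 's) \<Rightarrow> ('w \<Rightarrow> 's) \<Rightarrow> 'w \<Rightarrow> enat" where
  "mixing_time k X M w = (INF n\<in>{n. k \<le> n \<and> X n w = M w}. enat n)"

(* The expectation of the mixing time conditional on X 0 = i.  It is [0,\<infinity>]-valued, so that
   its being equal to a real number includes its finiteness.  Meaningful if X 0 = i has positive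
   probability. *)
definition expected_mixing_time ::
  "'w measure \<Rightarrow> nat \<Rightarrow> (nat \<Rightarrow> 'w \<Rightarrow> 's) \<Rightarrow> ('w \<Rightarrow> 's) \<Rightarrow> 's \<Rightarrow> ennreal" where
  "expected_mixing_time W k X M i =
     (\<integral>\<^sup>+ w. ennreal_of_enat (mixing_time k X M w)
        \<partial>uniform_measure W {w \<in> space W. X 0 w = i})"

end

theory Submission
  imports Defs
begin

text \<open>
  The expectation of a mixing time is the sum of its tail probabilities. Since \<open>M\<close> is independent of
  the chain, the tail event \<open>n < T\<close> may be computed for each value \<open>j\<close> of \<open>M\<close> separately, where it says
  that the chain avoids \<open>j\<close> up to time \<open>n\<close>. With two states this leaves a single path, which sits in
  the other state \<open>j'\<close>, so the tails are geometric with ratio \<open>1 - P\<^bsub>j'j\<^esub>\<close>. As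
  \<open>\<pi>\<^bsub>j\<^esub> / P\<^bsub>j'j\<^esub> = 1 / (a + b)\<close> for both \<open>j\<close>, the sums do not depend on the starting state.
\<close>

lemma less_mixing_time_iff:
  "enat n < mixing_time k X M w \<longleftrightarrow> (\<forall>m\<in>{k..n}. X m w \<noteq> M w)"
proof
  assume less: "enat n < mixing_time k X M w"
  show "\<forall>m\<in>{k..n}. X m w \<noteq> M w"
  proof (intro ballI notI)
    fix m assume "m \<in> {k..n}" "X m w = M w"
    then have "mixing_time k X M w \<le> enat m"
      unfolding mixing_time_def by (intro INF_lower) auto
    also have "\<dots> \<le> enat n" using \<open>m \<in> {k..n}\<close> by simp
    finally show False using less by simp
  qed
next
  assume *: "\<forall>m\<in>{k..n}. X m w \<noteq> M w"
  \<comment> \<open>A lower bound on every member also covers the case of no members, where the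
    infimum is \<infinity>.\<close>
  have "enat (Suc n) \<le> mixing_time k X M w"
    unfolding mixing_time_def
  proof (rule INF_greatest)
    fix m assume "m \<in> {n. k \<le> n \<and> X n w = M w}"
    then have "\<not> m \<le> n" using * by auto
    then show "enat (Suc n) \<le> enat m" by simp
  qed
  then show "enat n < mixing_time k X M w"
    by (metis enat_ord_simps(2) lessI less_le_trans)
qed

text \<open>The index set of the infimum varies with \<open>w\<close>. Giving the excluded times the
  value \<infinity> turns it into a countable infimum of measurable functions over a fixed index
  set.\<close>

lemma measurable_mixing_time:
  fixes X :: "nat \<Rightarrow> 'w \<Rightarrow> 's::finite"
  assumes [measurable]: "\<And>n. X n \<in> W \<rightarrow>\<^sub>M count_space UNIV" "M \<in> W \<rightarrow>\<^sub>M count_space UNIV"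
  shows "mixing_time k X M \<in> W \<rightarrow>\<^sub>M count_space UNIV"
proof -
  have "mixing_time k X M w = (INF n. if k \<le> n \<and> X n w = M w then enat n else \<infinity>)" for w
  proof (rule antisym)
    show "mixing_time k X M w \<le> (INF n. if k \<le> n \<and> X n w = M w then enat n else \<infinity>)"
      unfolding mixing_time_def by (rule INF_greatest) (auto intro: INF_lower)
    show "(INF n. if k \<le> n \<and> X n w = M w then enat n else \<infinity>) \<le> mixing_time k X M w"
      unfolding mixing_time_def
    proof (rule INF_greatest)
      fix n assume "n \<in> {n. k \<le> n \<and> X n w = M w}"
      then show "(INF n. if k \<le> n \<and> X n w = M w then enat n else \<infinity>) \<le> enat n"
        by (intro INF_lower2[of n]) simp_all
    qed
  qed
  then have eq: "mixing_time k X M = (\<lambda>w. INF n. if k \<le> n \<and> X n w = M w then enat n else \<infinity>)"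
    by auto
  show ?thesis unfolding eq by measurable
qed

text \<open>This is the tail sum formula for a variable with values in \<open>enat\<close>, applied
  under the conditional law. Positivity of the conditioning event lets the quotients of extended
  reals be read as real quotients.\<close>

lemma expected_mixing_time_eq_suminf:
  fixes X :: "nat \<Rightarrow> 'w \<Rightarrow> 's::finite"
  assumes "prob_space W"
    and [measurable]: "\<And>n. X n \<in> W \<rightarrow>\<^sub>M count_space UNIV" "M \<in> W \<rightarrow>\<^sub>M count_space UNIV"
    and pos: "\<P>(w in W. X 0 w = i) > 0"
  shows "expected_mixing_time W k X M i =
    (\<Sum>n. ennreal (\<P>(w in W. X 0 w = i \<and> enat n < mixing_time k X M w) / \<P>(w in W. X 0 w = i)))"
proof -
  interpret prob_space W by fact
  let ?A = "{w \<in> space W. X 0 w = i}"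
  let ?U = "uniform_measure W ?A"
  have T[measurable]: "mixing_time k X M \<in> W \<rightarrow>\<^sub>M count_space UNIV"
    using assms(2,3) by (rule measurable_mixing_time)
  have "expected_mixing_time W k X M i =
      (\<Sum>n. emeasure ?U {w \<in> space ?U. enat n < mixing_time k X M w})"
    unfolding expected_mixing_time_def by (intro nn_integral_enat_function) measurable
  also have "\<dots> = (\<Sum>n. ennreal (\<P>(w in W. X 0 w = i \<and> enat n < mixing_time k X M w)
      / \<P>(w in W. X 0 w = i)))"
  proof (intro suminf_cong)
    fix n
    have "emeasure ?U {w \<in> space ?U. enat n < mixing_time k X M w} =
        emeasure W (?A \<inter> {w \<in> space W. enat n < mixing_time k X M w}) / emeasure W ?A"
      unfolding space_uniform_measure by (rule emeasure_uniform_measure) measurable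
    also have "?A \<inter> {w \<in> space W. enat n < mixing_time k X M w} =
        {w \<in> space W. X 0 w = i \<and> enat n < mixing_time k X M w}" by auto
    finally show "emeasure ?U {w \<in> space ?U. enat n < mixing_time k X M w} =
        ennreal (\<P>(w in W. X 0 w = i \<and> enat n < mixing_time k X M w) / \<P>(w in W. X 0 w = i))"
      using pos by (simp add: emeasure_eq_measure divide_ennreal)
  qed
  finally show ?thesis .
qed

lemma markov_chain_path_prob:
  fixes X :: "nat \<Rightarrow> 'w \<Rightarrow> 's::finite"
  assumes "prob_space W" and mc: "markov_chain W P X"
  shows "\<P>(w in W. \<forall>k\<le>n. X k w = x k) = \<P>(w in W. X 0 w = x 0) * (\<Prod>m<n. P $ x m $ x (Suc m))"
proof (induction n)
  case 0
  show ?case by simp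
next
  case (Suc n)
  interpret prob_space W by fact
  have [measurable]: "X n \<in> W \<rightarrow>\<^sub>M count_space UNIV" for n
    using mc by (simp add: markov_chain_def)
  have split: "(\<forall>k\<le>Suc n. X k w = x k) \<longleftrightarrow> X (Suc n) w = x (Suc n) \<and> (\<forall>k\<le>n. X k w = x k)" for w
    by (auto simp: le_Suc_eq)
  have "\<P>(w in W. \<forall>k\<le>Suc n. X k w = x k) = \<P>(w in W. \<forall>k\<le>n. X k w = x k) * P $ x n $ x (Suc n)"
  proof (cases "\<P>(w in W. \<forall>k\<le>n. X k w = x k) > 0")
    case True
    with mc have "\<P>(w in W. X (Suc n) w = x (Suc n) \<bar> \<forall>k\<le>n. X k w = x k) = P $ x n $ x (Suc n)"
      unfolding markov_chain_def by blast
    with True show ?thesis unfolding cond_prob_def split by (simp add: field_simps)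
  next
    \<comment> \<open>On a null path the Markov property says nothing, but extending the path keeps
      the probability 0, so both sides vanish.\<close>
    case False
    then have zero: "\<P>(w in W. \<forall>k\<le>n. X k w = x k) = 0"
      by (simp add: zero_less_measure_iff)
    have "\<P>(w in W. \<forall>k\<le>Suc n. X k w = x k) \<le> \<P>(w in W. \<forall>k\<le>n. X k w = x k)"
      by (intro finite_measure_mono) auto
    then show ?thesis unfolding zero by (simp add: measure_le_0_iff)
  qed
  then show ?case using Suc by simp
qed

text \<open>On \<open>M w = j\<close> the random target is frozen, and what remains is an event of
  the process alone, so independence splits each summand into a product.\<close>

lemma prob_less_mixing_time:
  fixes X :: "nat \<Rightarrow> 'w \<Rightarrow> 's::finite"
  assumes "prob_space W" and [measurable]: "\<And>n. X n \<in> W \<rightarrow>\<^sub>M count_space UNIV"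
    and ind: "indep_of_process W M X"
  shows "\<P>(w in W. X 0 w = i \<and> enat n < mixing_time k X M w) =
    (\<Sum>j\<in>UNIV. \<P>(w in W. M w = j) * \<P>(w in W. X 0 w = i \<and> (\<forall>m\<in>{k..n}. X m w \<noteq> j)))"
proof -
  interpret prob_space W by fact
  have [measurable]: "M \<in> W \<rightarrow>\<^sub>M count_space UNIV"
    using ind by (simp add: indep_of_process_def)
  let ?E = "\<lambda>j. {w \<in> space W. X 0 w = i \<and> (\<forall>m\<in>{k..n}. X m w \<noteq> j)}"
  let ?S = "\<Pi>\<^sub>M n\<in>(UNIV::nat set). count_space (UNIV::'s set)"
  have "\<P>(w in W. X 0 w = i \<and> enat n < mixing_time k X M w) =
      measure W (\<Union>j\<in>UNIV. {w \<in> space W. M w = j} \<inter> ?E j)"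
    by (intro arg_cong[where f = "measure W"]) (auto simp: less_mixing_time_iff)
  also have "\<dots> = (\<Sum>j\<in>UNIV. measure W ({w \<in> space W. M w = j} \<inter> ?E j))"
    by (intro finite_measure_finite_Union) (auto simp: disjoint_family_on_def)
  also have "\<dots> = (\<Sum>j\<in>UNIV. \<P>(w in W. M w = j) * measure W (?E j))"
  proof (intro sum.cong refl)
    fix j
    have 1: "{w \<in> space W. M w = j} \<in> sets (vimage_algebra (space W) M (count_space UNIV))"
      using in_vimage_algebra[of "{j}" "count_space UNIV" M "space W"]
      by (simp add: vimage_def Int_def conj_commute)
    \<comment> \<open>The event restricts finitely many coordinates, so it is the preimage of a
      measurable set of paths and lies in the \<sigma>-algebra generated by the whole
      process.\<close>
    have "{y \<in> space ?S. y 0 = i \<and> (\<forall>m\<in>{k..n}. y m \<noteq> j)} \<in> sets ?S" by measurable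
    from in_vimage_algebra[OF this, of "\<lambda>w n. X n w" "space W"]
    have 2: "?E j \<in> sets (vimage_algebra (space W) (\<lambda>w n. X n w) ?S)"
      by (simp add: vimage_def Int_def conj_commute space_PiM)
    show "measure W ({w \<in> space W. M w = j} \<inter> ?E j) = \<P>(w in W. M w = j) * measure W (?E j)"
      using ind 1 2 unfolding indep_of_process_def by (intro indep_setD) auto
  qed
  finally show ?thesis .
qed

text \<open>Arithmetic in the type \<open>2\<close> is modulo 2, so adding 1 swaps the two states.
  Writing \<open>j + 1\<close> for the other state lets one argument serve both states.\<close>

lemma two_add_one: "2 + 1 = (1::2)"
  by simp

lemma two_neq_one: "2 \<noteq> (1::2)"
  by simp

lemma neq_iff_eq_plus_1: "x \<noteq> j \<longleftrightarrow> x = j + 1" for x j :: 2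
proof -
  have "\<forall>x j :: 2. x \<noteq> j \<longleftrightarrow> x = j + 1"
    unfolding forall_2 one_add_one two_add_one by (simp only: two_neq_one two_neq_one[symmetric] simp_thms)
  then show ?thesis by blast
qed

lemma plus_1_plus_1: "j + 1 + 1 = j" for j :: 2
  using exhaust_2[of j] by (elim disjE) (simp_all only: one_add_one two_add_one)

lemma sum_UNIV_2: "(\<Sum>j\<in>UNIV. f j) = f i + f (i + 1)" for f :: "2 \<Rightarrow> 'b::comm_monoid_add"
  using exhaust_2[of i]
  by (elim disjE) (simp_all only: sum_2 one_add_one two_add_one, rule add.commute)

text \<open>These facts hide which state carries \<open>a\<close> and which carries
  \<open>b\<close>. The last one reads the stationary weight of \<open>j\<close> as proportional to
  the probability of entering \<open>j\<close> from the other state.\<close>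

lemma two_state_matrix_entries:
  "two_state_matrix a b $ j $ j = 1 - two_state_matrix a b $ j $ (j + 1)"
  "0 < a \<Longrightarrow> 0 < b \<Longrightarrow> 0 < two_state_matrix a b $ j $ (j + 1)"
  "a \<le> 1 \<Longrightarrow> b \<le> 1 \<Longrightarrow> two_state_matrix a b $ j $ (j + 1) \<le> 1"
  "two_state_matrix a b $ j $ (j + 1) + two_state_matrix a b $ (j + 1) $ j = a + b"
  "two_state_stationary a b $ j = two_state_matrix a b $ (j + 1) $ j / (a + b)"
proof -
  let ?Q = "two_state_matrix a b"
  have "\<forall>j. ?Q $ j $ j = 1 - ?Q $ j $ (j + 1) \<and>
      (0 < a \<longrightarrow> 0 < b \<longrightarrow> 0 < ?Q $ j $ (j + 1)) \<and>
      (a \<le> 1 \<longrightarrow> b \<le> 1 \<longrightarrow> ?Q $ j $ (j + 1) \<le> 1) \<and>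
      ?Q $ j $ (j + 1) + ?Q $ (j + 1) $ j = a + b \<and>
      two_state_stationary a b $ j = ?Q $ (j + 1) $ j / (a + b)"
    unfolding forall_2 one_add_one two_add_one
    by (simp add: two_state_matrix_def two_state_stationary_def)
  then show "?Q $ j $ j = 1 - ?Q $ j $ (j + 1)"
    "0 < a \<Longrightarrow> 0 < b \<Longrightarrow> 0 < ?Q $ j $ (j + 1)"
    "a \<le> 1 \<Longrightarrow> b \<le> 1 \<Longrightarrow> ?Q $ j $ (j + 1) \<le> 1"
    "?Q $ j $ (j + 1) + ?Q $ (j + 1) $ j = a + b"
    "two_state_stationary a b $ j = ?Q $ (j + 1) $ j / (a + b)"
    by blast+
qed

theorem theorem3p3:
  fixes a b d :: real
    and W :: "'w measure"
    and X :: "nat \<Rightarrow> 'w \<Rightarrow> 2"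
    and M :: "'w \<Rightarrow> 2"
  assumes "0 < a" "a \<le> 1" "0 < b" "b \<le> 1"
    and "d = 1 - a - b"
    and "prob_space W"
    and "markov_chain W (two_state_matrix a b) X"
    and "indep_of_process W M X"
    and "\<And>j. \<P>(w in W. M w = j) = two_state_stationary a b $ j"
  shows "\<forall>i. \<P>(w in W. X 0 w = i) > 0 \<longrightarrow>
    expected_mixing_time W 0 X M i = ennreal (1 / (1 - d)) \<and>
    expected_mixing_time W 1 X M i = ennreal (1 + 1 / (1 - d))"
proof (intro allI impI)
  fix i
  assume pos: "\<P>(w in W. X 0 w = i) > 0"
  define Q where "Q = two_state_matrix a b"
  define \<pi> where "\<pi> j = Q $ (j + 1) $ j / (a + b)" for j
  define c where "c = \<P>(w in W. X 0 w = i)"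
  have c: "c > 0" using pos by (simp add: c_def)
  have Qdiag: "Q $ j $ j = 1 - Q $ j $ (j + 1)"
    and Qpos: "0 < Q $ j $ (j + 1)" and Qle: "Q $ j $ (j + 1) \<le> 1" for j
    unfolding Q_def using assms(1-4) two_state_matrix_entries[of a b j] by simp_all
  have X: "\<And>n. X n \<in> W \<rightarrow>\<^sub>M count_space UNIV" and M: "M \<in> W \<rightarrow>\<^sub>M count_space UNIV"
    using assms(7,8) by (simp_all add: markov_chain_def indep_of_process_def)
  have path: "\<P>(w in W. \<forall>k\<le>n. X k w = x k) = \<P>(w in W. X 0 w = x 0) * (\<Prod>m<n. Q $ x m $ x (Suc m))"
    for n x
    unfolding Q_def using assms(6,7) by (rule markov_chain_path_prob)
  have geom: "(\<lambda>n. \<pi> j * Q $ (j + 1) $ (j + 1) ^ n) sums (1 / (a + b))" for j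
  proof -
    let ?q = "Q $ (j + 1) $ (j + 1)"
    \<comment> \<open>The probability of leaving \<open>j + 1\<close> is also the numerator of
      \<open>\<pi> j\<close> and cancels in the limit. Its lying in (0, 1] gives 0 \<le>
      \<open>?q\<close> < 1; if \<open>?q\<close> is 0, only the term for \<open>n = 0\<close>
      survives.\<close>
    have q: "1 - ?q = Q $ (j + 1) $ j" using Qdiag[of "j + 1"] by (simp add: plus_1_plus_1)
    have q0: "0 < Q $ (j + 1) $ j" and q1: "Q $ (j + 1) $ j \<le> 1"
      using Qpos[of "j + 1"] Qle[of "j + 1"] by (simp_all add: plus_1_plus_1)
    have "(\<lambda>n. \<pi> j * ?q ^ n) sums (\<pi> j * (1 / (1 - ?q)))"
      using q q0 q1 by (intro sums_mult geometric_sums) auto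
    then show ?thesis using q0 unfolding q \<pi>_def by simp
  qed
  have \<pi>_sum: "\<pi> i + \<pi> (i + 1) = 1"
    unfolding \<pi>_def plus_1_plus_1 add_divide_distrib[symmetric] Q_def
    using assms(1,3) two_state_matrix_entries(4)[of a b i] by (simp add: add.commute)
  have tail: "\<P>(w in W. X 0 w = i \<and> enat n < mixing_time k X M w) =
      (\<Sum>j\<in>UNIV. \<pi> j * \<P>(w in W. X 0 w = i \<and> (\<forall>m\<in>{k..n}. X m w = j + 1)))" for n k
    using prob_less_mixing_time[OF assms(6) X assms(8)]
    by (simp add: assms(9) two_state_matrix_entries(5) \<pi>_def Q_def neq_iff_eq_plus_1)
  have expectation: "expected_mixing_time W k X M i =
      (\<Sum>n. ennreal (\<P>(w in W. X 0 w = i \<and> enat n < mixing_time k X M w) / c))" for k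
    unfolding c_def using assms(6) X M pos by (rule expected_mixing_time_eq_suminf)
  have "expected_mixing_time W 0 X M i = ennreal (1 / (a + b))"
  proof -
    \<comment> \<open>Time 0 counts here, so the target \<open>i\<close> is met at once and only the
      target \<open>i + 1\<close> contributes, by staying in \<open>i\<close> for \<open>n\<close>
      steps. The unreduced \<open>i + 1 + 1\<close> matches \<open>geom\<close> at
      \<open>i + 1\<close>.\<close>
    have t: "\<P>(w in W. X 0 w = i \<and> enat n < mixing_time 0 X M w) / c =
        \<pi> (i + 1) * Q $ (i + 1 + 1) $ (i + 1 + 1) ^ n" for n
    proof -
      have empty: "{w \<in> space W. X 0 w = i \<and> (\<forall>m\<in>{0..n}. X m w = i + 1)} = {}"
        using neq_iff_eq_plus_1[of i i] by force
      have const: "{w \<in> space W. X 0 w = i \<and> (\<forall>m\<in>{0..n}. X m w = i + 1 + 1)} =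
          {w \<in> space W. \<forall>m\<le>n. X m w = i}"
        unfolding plus_1_plus_1 by (metis atLeastAtMost_iff le0)
      show ?thesis
        unfolding tail sum_UNIV_2[of _ i] empty const using c path[of n "\<lambda>_. i"]
        by (simp add: plus_1_plus_1 c_def)
    qed
    show ?thesis
      unfolding expectation
      using geom[of "i + 1"] c unfolding t[symmetric] by (intro suminf_ennreal_eq) auto
  qed
  moreover have "expected_mixing_time W 1 X M i = ennreal (1 + 1 / (a + b))"
  proof -
    let ?f = "\<lambda>n. \<P>(w in W. X 0 w = i \<and> enat n < mixing_time 1 X M w) / c"
    \<comment> \<open>The interval \<open>{1..0}\<close> is empty, so this tail is certain; it
      supplies the extra 1 in the result.\<close>
    have f0: "?f 0 = 1"
      unfolding tail sum_UNIV_2[of _ i] using c \<pi>_sum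
      by (simp add: c_def[symmetric] distrib_right[symmetric])
    \<comment> \<open>Now both targets contribute: the first step goes from \<open>i\<close> to the
      state \<open>j + 1\<close>, which may be \<open>i\<close> itself, and \<open>n\<close> stays
      there follow.\<close>
    have fSuc: "?f (Suc n) =
        (\<Sum>j\<in>UNIV. Q $ i $ (j + 1) * (\<pi> j * Q $ (j + 1) $ (j + 1) ^ n))" for n
    proof -
      have "\<P>(w in W. X 0 w = i \<and> (\<forall>m\<in>{1..Suc n}. X m w = j + 1)) =
          c * (Q $ i $ (j + 1) * Q $ (j + 1) $ (j + 1) ^ n)" for j
      proof -
        let ?x = "\<lambda>m. if m = 0 then i else j + 1"
        have "(X 0 w = i \<and> (\<forall>m\<in>{1..Suc n}. X m w = j + 1)) \<longleftrightarrow> (\<forall>m\<le>Suc n. X m w = ?x m)" for w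
          by (metis One_nat_def Suc_le_eq atLeastAtMost_iff le0 not_gr0)
        \<comment> \<open>Splitting the product at its front isolates the first transition; all
          later factors are equal.\<close>
        then show ?thesis
          using path[of "Suc n" ?x] by (simp add: c_def prod.lessThan_Suc_shift del: prod.lessThan_Suc)
      qed
      then show ?thesis unfolding tail sum_divide_distrib using c
        by (intro sum.cong) simp_all
    qed
    have "(\<lambda>n. ?f (Suc n)) sums (\<Sum>j\<in>UNIV. Q $ i $ (j + 1) * (1 / (a + b)))"
      unfolding fSuc by (intro sums_sum sums_mult geom)
    \<comment> \<open>Row \<open>i\<close> of the matrix sums to 1, so averaging the common limit
      over the first step leaves it unchanged.\<close>
    also have "(\<Sum>j\<in>UNIV. Q $ i $ (j + 1) * (1 / (a + b))) = 1 / (a + b)"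
      unfolding sum_UNIV_2[of _ i] distrib_right[symmetric] by (simp add: plus_1_plus_1 Qdiag)
    finally have "?f sums (1 / (a + b) + ?f 0)" by (rule sums_Suc)
    then have "?f sums (1 + 1 / (a + b))" unfolding f0 by (simp add: add.commute)
    then show ?thesis
      unfolding expectation
      using c by (intro suminf_ennreal_eq) auto
  qed
  ultimately show "expected_mixing_time W 0 X M i = ennreal (1 / (1 - d)) \<and>
      expected_mixing_time W 1 X M i = ennreal (1 + 1 / (1 - d))"
    by (simp add: assms(5))
qed

end
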